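(* Let $S\subset \mathbb{Z}^n$ be a realizable set, and let $S_1=\{x\in S: (x_1-1,\dots,x_n-1)\in S\}$ and $S_0=S\setminus S_1$. Then there exists a realization $(T,W)$ of $S$ with $T$ a tree if and only if both of the following hold: (i) for every $x,y\in S$ with $\max_{i\in[n]}|x_i-y_i|=1$, we have $x_j\neq y_j$ for every $j\in[n]$; (ii) for every $x\in S_0$ and every $j\in[n]$ with $x_j>0$, there exists exactly one $y\in S_0$ with $\max_{i\in[n]}|x_i-y_i|=1$ and $y_j=x_j-1$.
   Context: All graphs are finite, simple and connected. For a graph $G$ and an ordered vertex subset $W=\{\omega^1,\dots,\omega^n\}$, $r(u\mid W)=(d(u,\omega^1),\dots,d(u,\omega^n))$; $W$ is resolving if these vectors are pairwise distinct. A finite $S\subset\mathbb{Z}^n$ is realizable if there exist a graph $G$ and a resolving set $W$ with $S=\{r(u\mid W):u\in V(G)\}$; $(G,W)$ is then a realization of $S$. *)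

theory Defs
  imports
    "HOL-Analysis.Finite_Cartesian_Product"
    "Graph_Theory.Graph_Theory"
begin

text \<open>
  Finite simple graphs are the symmetric loop-free pair digraphs of locale
  \<^locale>\<open>pair_graph\<close>: an edge joining \<open>u\<close> and \<open>v\<close> is the pair of arcs \<open>(u, v)\<close>, \<open>(v, u)\<close>.
  Connectedness includes having at least one vertex.
\<close>

definition connected_graph :: "'v pair_pre_digraph \<Rightarrow> bool" where
  "connected_graph G \<longleftrightarrow> pair_graph G \<and> Digraph_Component.connected (with_proj G)"

text \<open>
  The library constant \<^const>\<open>Digraph_Component.tree\<close> is about directed cycles, so in this
  encoding it fails for every graph with an edge (\<open>u \<rightarrow> v \<rightarrow> u\<close> is a directed cycle).
  The cycles of the undirected graph are the directed cycles of length at least three.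
\<close>

definition tree_graph :: "'v pair_pre_digraph \<Rightarrow> bool" where
  "tree_graph G \<longleftrightarrow> connected_graph G \<and>
     \<not> (\<exists>p. pre_digraph.cycle (with_proj G) p \<and> 3 \<le> length p)"

text \<open>Only meaningful when \<open>u\<close> and \<open>v\<close> are joined by a walk.\<close>

definition graph_dist :: "'v pair_pre_digraph \<Rightarrow> 'v \<Rightarrow> 'v \<Rightarrow> nat" where
  "graph_dist G u v = (LEAST k. \<exists>p. pre_digraph.awalk (with_proj G) u p v \<and> length p = k)"

text \<open>Agreement with the shortest-path cost of the library for unit arc weights.\<close>

lemma graph_dist_eq_shortest_path:
  assumes G: "connected_graph G" and u: "u \<in> pverts G" and v: "v \<in> pverts G"
  shows "wf_digraph.\<mu> (with_proj G) (\<lambda>_. 1) u v = ereal (real (graph_dist G u v))"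
proof -
  interpret pair_graph G
    using G by (simp add: connected_graph_def)
  have "strongly_connected (with_proj G)"
    using G by (auto simp: connected_graph_def intro: symmetric_connected_imp_strongly_connected)
  then have "u \<rightarrow>\<^sup>*\<^bsub>with_proj G\<^esub> v"
    using u v by (auto simp: strongly_connected_def)
  then have ex: "\<exists>k p. awalk u p v \<and> length p = k"
    by (auto simp: reachable_awalk)
  obtain p where p: "awalk u p v" "length p = graph_dist G u v"
    using LeastI_ex[OF ex] by (auto simp: graph_dist_def)
  have le: "graph_dist G u v \<le> length q" if "awalk u q v" for q
    unfolding graph_dist_def using that by (intro Least_le) auto
  have cost: "awalk_cost (\<lambda>_. 1) q = real (length q)" for q :: "('a \<times> 'a) list"
    by (induct q) auto
  show ?thesis
    unfolding \<mu>_def cost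
  proof (rule INF_eqI)
    fix q assume "q \<in> {p. awalk u p v}"
    then show "ereal (real (graph_dist G u v)) \<le> ereal (real (length q))"
      using le by auto
  next
    fix y assume "\<And>q. q \<in> {p. awalk u p v} \<Longrightarrow> y \<le> ereal (real (length q))"
    then show "y \<le> ereal (real (graph_dist G u v))"
      using p by force
  qed
qed

text \<open>
  An ordered vertex subset \<open>{\<omega>\<^sup>1, \<dots>, \<omega>\<^sup>n}\<close> is an injective family \<open>W\<close> of vertices over a
  finite index type \<open>'n\<close> with \<open>n\<close> elements.
\<close>

definition dist_vector :: "'v pair_pre_digraph \<Rightarrow> ('n::finite \<Rightarrow> 'v) \<Rightarrow> 'v \<Rightarrow> int ^ 'n" where
  "dist_vector G W u = (\<chi> i. int (graph_dist G u (W i)))"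

definition resolving :: "'v pair_pre_digraph \<Rightarrow> ('n::finite \<Rightarrow> 'v) \<Rightarrow> bool" where
  "resolving G W \<longleftrightarrow> inj W \<and> range W \<subseteq> pverts G \<and> inj_on (dist_vector G W) (pverts G)"

definition is_realization ::
    "(int ^ 'n::finite) set \<Rightarrow> 'v pair_pre_digraph \<Rightarrow> ('n \<Rightarrow> 'v) \<Rightarrow> bool" where
  "is_realization S G W \<longleftrightarrow>
     connected_graph G \<and> resolving G W \<and> S = dist_vector G W ` pverts G"

text \<open>
  Vertices are taken in \<^typ>\<open>nat\<close> without loss of generality, every finite graph being
  isomorphic to one with such vertices.
\<close>

definition realizable :: "(int ^ 'n::finite) set \<Rightarrow> bool" where
  "realizable S \<longleftrightarrow>
     finite S \<and> (\<exists>(G :: nat pair_pre_digraph) W. is_realization S G W)"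

end

theory Submission
  imports Defs
begin

text \<open>
  In a tree, adjacent vertices have different distances to every vertex \<open>w\<close>, and a vertex has
  exactly one neighbour closer to \<open>w\<close>; otherwise two shortest walks to \<open>w\<close> would close up to a
  cycle. Hence all coordinates of \<open>r(u) - r(v)\<close> have the parity of \<open>d(u, v)\<close>, which gives (i).
  The set \<open>S\<^sub>0\<close> consists of the vectors of the vertices in the subtree spanned by \<open>W\<close>; there,
  max-distance 1 means adjacency, because a path towards a vertex of the subtree extends to a
  shortest path ending in \<open>W\<close>. So (ii) is the uniqueness of the closer neighbour.

  Conversely, join two vertices of \<open>S\<^sub>0\<close> when they are at max-distance 1, and every \<open>x \<in> S\<^sub>1\<close> to
  \<open>x - (1, \<dots>, 1)\<close>. By (i) and (ii), every edge changes the coordinate \<open>j\<close> by exactly 1 and every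
  \<open>x\<close> with \<open>x\<^sub>j > 0\<close> has exactly one neighbour with a smaller \<open>j\<close>-th coordinate. Hence \<open>x\<^sub>j\<close> is
  the distance to \<open>\<omega>\<^sup>j\<close> in the new graph, which has no cycle: at a vertex of
  the cycle with maximal \<open>x\<^sub>j\<close>, both neighbours would have a smaller \<open>j\<close>-th coordinate.
\<close>

section \<open>Height functions: recognising distances and excluding cycles\<close>

text \<open>An arc lowers \<open>f\<close> by at most 1, so a walk from \<open>a\<close> to
  \<open>w\<close> has at least \<open>f a\<close> arcs; following \<open>desc\<close> gives a walk
  with exactly that many. It is applied later to a new graph, with \<open>f\<close> a distance of
  the old one.\<close>

lemma (in pair_wf_digraph) graph_dist_eqI:
  fixes f :: "'a \<Rightarrow> nat"
  assumes arc: "\<And>a b. (a, b) \<in> parcs G \<Longrightarrow> f a \<le> Suc (f b)"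
    and desc: "\<And>a. a \<in> pverts G \<Longrightarrow> f a \<noteq> 0 \<Longrightarrow> \<exists>b. (a, b) \<in> parcs G \<and> f a = Suc (f b)"
    and zero: "\<And>a. a \<in> pverts G \<Longrightarrow> f a = 0 \<Longrightarrow> a = w"
    and w: "f w = 0" and u: "u \<in> pverts G"
  shows "\<exists>p. awalk u p w" and "graph_dist G u w = f u"
proof -
  have ex: "\<exists>p. awalk a p w \<and> length p = f a" if "a \<in> pverts G" for a
    using that
  proof (induction "f a" arbitrary: a)
    case 0
    then show ?case using zero[of a] by (auto simp: awalk_Nil_iff intro!: exI[of _ "[]"])
  next
    case (Suc k)
    then obtain b where b: "(a, b) \<in> parcs G" "f a = Suc (f b)"
      using desc[of a] by auto
    then obtain p where "awalk b p w" "length p = f b"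
      using Suc by (metis in_arcsD2 Suc_inject)
    with b show ?case
      by (intro exI[of _ "(a, b) # p"]) (auto simp: awalk_Cons_iff)
  qed
  then show "\<exists>p. awalk u p w" using u by blast
  have "f a \<le> length p" if "awalk a p w" for a p
    using that
  proof (induction p arbitrary: a)
    case Nil
    then show ?case using w by (simp add: awalk_Nil_iff)
  next
    case (Cons e p)
    then show ?case using arc[of a "snd e"] by (cases e) (force simp: awalk_Cons_iff)
  qed
  with ex[OF u] show "graph_dist G u w = f u"
    unfolding graph_dist_def by (intro Least_equality) auto
qed

text \<open>At a vertex of the cycle where \<open>f\<close> is maximal, successor and predecessor
  both lie strictly lower, so \<open>unique\<close> identifies them; a cycle of length at least 3
  keeps them apart.\<close>

lemma (in pair_sym_digraph) no_cycle_if_unique_descent: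
  fixes f :: "'a \<Rightarrow> nat"
  assumes neq: "\<And>a b. (a, b) \<in> parcs G \<Longrightarrow> f a \<noteq> f b"
    and unique: "\<And>a b c. (a, b) \<in> parcs G \<Longrightarrow> (a, c) \<in> parcs G \<Longrightarrow>
      f b < f a \<Longrightarrow> f c < f a \<Longrightarrow> b = c"
    and cyc: "cycle p" and len: "3 \<le> length p"
  shows False
proof -
  obtain u where u: "awalk u p u" "distinct (tl (awalk_verts u p))" "p \<noteq> []"
    using cyc by (auto simp: cycle_def)
  have cas: "pcas u p u" using u by (auto simp: awalk_def)
  have dist: "distinct (map snd p)"
    using u awalk_verts_conv'[OF cas] by simp
  have "Max ((\<lambda>e. f (fst e)) ` set p) \<in> (\<lambda>e. f (fst e)) ` set p"
    using u(3) by (intro Max_in) auto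
  then obtain e where e: "e \<in> set p" "f (fst e) = Max ((\<lambda>e. f (fst e)) ` set p)"
    by auto
  have max: "f (fst e') \<le> f (fst e)" if "e' \<in> set p" for e'
    unfolding e(2) using that by (intro Max_ge) auto
  from e(1) obtain q r where qr: "p = q @ e # r" by (meson split_list)
  \<comment> \<open>The cycle is rotated to start at the maximal vertex \<open>fst e\<close>;
    rotation keeps the set of arcs and the distinctness of their heads.\<close>
  let ?c = "(e # r) @ q"
  have c: "awalk (fst e) ?c (fst e)"
    using u qr by (auto simp: awalk_Cons_iff intro: awalk_appendI)
  \<comment> \<open>The last arc \<open>l\<close> returns to the maximal vertex and \<open>g\<close>
    ends at its predecessor. With at least three arcs, \<open>e\<close> and \<open>g\<close> occupy
    different positions, so their heads differ.\<close>
  obtain s g l where sgl: "?c = e # s @ [g, l]"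
  proof -
    have l: "2 \<le> length (r @ q)" using len qr by simp
    then obtain t l where t: "r @ q = t @ [l]" by (metis append_is_Nil_conv list.size(3) not_numeral_le_zero rev_exhaust)
    then obtain s g where "t = s @ [g]" using l by (cases t rule: rev_cases) auto
    with t that show thesis by auto
  qed
  have set_c: "set ?c = set p" using qr by auto
  have "distinct (map snd ?c)" using dist qr by auto
  then have neq_ends: "snd e \<noteq> snd g" unfolding sgl by simp
  have gl: "snd g = fst l" "snd l = fst e"
    using c unfolding sgl by (auto simp: awalk_Cons_iff)
  have arcs: "e \<in> parcs G" "l \<in> parcs G"
    using c unfolding sgl by (auto simp: awalk_def)
  then have m: "(fst e, snd e) \<in> parcs G" "(fst e, fst l) \<in> parcs G"
    using gl arcs_symmetric by (metis prod.collapse)+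
  have "snd e = fst (hd (s @ [g, l]))"
    using c unfolding sgl by (cases s) (auto simp: awalk_Cons_iff)
  then have "snd e \<in> fst ` set p" "fst l \<in> fst ` set p"
    using set_c unfolding sgl by (cases s; force)+
  then have "f (snd e) \<le> f (fst e)" "f (fst l) \<le> f (fst e)" using max by auto
  then have "f (snd e) < f (fst e)" "f (fst l) < f (fst e)"
    using neq[OF m(1)] neq[OF m(2)] by auto
  from unique[OF m this] gl neq_ends show False by simp
qed

section \<open>Distances in connected graphs\<close>

locale connected_pair_graph = pair_graph +
  assumes connected: "Digraph_Component.connected (with_proj G)"
begin

abbreviation d :: "'a \<Rightarrow> 'a \<Rightarrow> nat" where "d \<equiv> graph_dist G"

lemma graph_dist_awalk:
  assumes "u \<in> pverts G" "v \<in> pverts G"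
  obtains p where "awalk u p v" "length p = d u v"
proof -
  have "strongly_connected (with_proj G)"
    using connected by (auto intro: symmetric_connected_imp_strongly_connected)
  then have "u \<rightarrow>\<^sup>*\<^bsub>with_proj G\<^esub> v"
    using assms by (auto simp: strongly_connected_def)
  then have "\<exists>k p. awalk u p v \<and> length p = k"
    by (auto simp: reachable_awalk)
  from LeastI_ex[OF this] that show thesis
    by (auto simp: graph_dist_def)
qed

lemma graph_dist_le: "awalk u p v \<Longrightarrow> d u v \<le> length p"
  unfolding graph_dist_def by (intro Least_le) auto

lemma graph_dist_eq_0_iff:
  assumes "u \<in> pverts G" "v \<in> pverts G"
  shows "d u v = 0 \<longleftrightarrow> u = v"
proof
  assume "d u v = 0"
  then show "u = v" using graph_dist_awalk[OF assms] by (metis awalk_empty_ends length_0_conv)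
qed (use assms graph_dist_le[of u "[]" v] in \<open>auto simp: awalk_Nil_iff\<close>)

lemma graph_dist_commute:
  assumes "u \<in> pverts G" "v \<in> pverts G"
  shows "d u v = d v u"
proof -
  have len: "length (rev_path p) = length p" for p :: "('a \<times> 'a) awalk"
    by (induction p) auto
  have "d a b \<le> d b a" if "a \<in> pverts G" "b \<in> pverts G" for a b
    using that by (metis graph_dist_awalk graph_dist_le awalk_rev_path len)
  with assms show ?thesis by (metis le_antisym)
qed

lemma graph_dist_arc_le:
  assumes "(u, v) \<in> parcs G" "w \<in> pverts G"
  shows "d u w \<le> Suc (d v w)"
proof -
  obtain p where "awalk v p w" "length p = d v w"
    using graph_dist_awalk assms in_arcsD2 by metis
  then show ?thesis
    using graph_dist_le[of u "(u, v) # p" w] assms by (auto simp: awalk_Cons_iff)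
qed

lemma graph_dist_descend:
  assumes "u \<in> pverts G" "w \<in> pverts G" "d u w \<noteq> 0"
  obtains v where "(u, v) \<in> parcs G" "d u w = Suc (d v w)"
proof -
  obtain p where p: "awalk u p w" "length p = d u w"
    using graph_dist_awalk assms by metis
  then obtain v q where q: "p = (u, v) # q"
    using assms(3) by (cases p) (auto simp: awalk_Cons_iff)
  then have a: "(u, v) \<in> parcs G" "awalk v q w" using p by (auto simp: awalk_Cons_iff)
  then have "d v w \<le> length q" by (intro graph_dist_le)
  then have "d u w = Suc (d v w)"
    using graph_dist_arc_le[OF a(1) assms(2)] p q by simp
  with a that show thesis by blast
qed

lemma graph_dist_eq_1_imp_arc:
  assumes "u \<in> pverts G" "v \<in> pverts G" "d u v = 1"
  shows "(u, v) \<in> parcs G"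
proof -
  obtain x where "(u, x) \<in> parcs G" "d u v = Suc (d x v)"
    using graph_dist_descend[of u v] assms by auto
  then show ?thesis using assms graph_dist_eq_0_iff in_arcsD2 by auto
qed

text \<open>Two shortest walks to \<open>w\<close>, cut where they first meet.\<close>

lemma apath_through_ball:
  assumes "w \<in> pverts G" "a \<in> pverts G" "b \<in> pverts G" "a \<noteq> b" "d a w = k" "d b w = k"
  shows "\<exists>p. apath a p b \<and> 2 \<le> length p \<and>
    set (awalk_verts a p) \<subseteq> {a, b} \<union> {x. d x w < k}"
  using assms(2-)
proof (induction k arbitrary: a b)
  case 0
  then show ?case using graph_dist_eq_0_iff assms(1) by metis
next
  case (Suc k)
  obtain a' b' where a': "(a, a') \<in> parcs G" "d a' w = k" and b': "(b, b') \<in> parcs G" "d b' w = k"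
    using graph_dist_descend[of a w] graph_dist_descend[of b w] Suc.prems assms(1)
    by (metis Suc_inject nat.distinct(1))
  have sym: "(b', b) \<in> parcs G" using b' arcs_symmetric by blast
  have verts: "a' \<in> pverts G" "b' \<in> pverts G" using a' b' in_arcsD2 by auto
  \<comment> \<open>Whether or not the two descents have already met, the middle piece stays within
    distance \<open>k\<close> of \<open>w\<close> and so avoids \<open>a\<close> and
    \<open>b\<close>, which are at distance \<open>Suc k\<close>.\<close>
  have "\<exists>q. apath a' q b' \<and> set (awalk_verts a' q) \<subseteq> {x. d x w \<le> k}"
  proof (cases "a' = b'")
    case True
    then show ?thesis using verts a' by (intro exI[of _ "[]"]) (auto simp: apath_Nil_iff)
  next
    case False
    from Suc.IH[OF verts False a'(2) b'(2)] obtain q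
      where "apath a' q b'" "set (awalk_verts a' q) \<subseteq> {a', b'} \<union> {x. d x w < k}" by blast
    then show ?thesis using a' b' by (intro exI[of _ q]) auto
  qed
  then obtain q where q: "apath a' q b'" "set (awalk_verts a' q) \<subseteq> {x. d x w \<le> k}" by blast
  have last: "last (awalk_verts a' q) = b'" using q(1) by (auto simp: apath_def)
  have "apath b' [(b', b)] b"
    using sym Suc.prems verts no_loops'[OF sym] by (auto simp: apath_simps)
  moreover have "b \<notin> set (awalk_verts a' q)" using q Suc.prems by auto
  ultimately have qb: "apath a' (q @ [(b', b)]) b"
    using q last by (auto simp: apath_append_iff)
  then have verts_qb: "awalk_verts a' (q @ [(b', b)]) = awalk_verts a' q @ [b]"
    using awalk_verts_append[of a' q "[(b', b)]" b] last by (simp add: apath_def)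
  then have "a \<notin> set (awalk_verts a' (q @ [(b', b)]))" using q Suc.prems by auto
  then have "apath a ((a, a') # q @ [(b', b)]) b"
    using qb a' by (auto simp: apath_Cons_iff)
  moreover have "set (awalk_verts a ((a, a') # q @ [(b', b)])) \<subseteq> {a, b} \<union> {x. d x w < Suc k}"
    using verts_qb q by auto
  ultimately show ?case by (intro exI[of _ "(a, a') # q @ [(b', b)]"]) auto
qed

end

section \<open>Descent, parity and separation in trees\<close>

locale pair_tree = connected_pair_graph +
  assumes acyclic: "\<And>p. cycle p \<Longrightarrow> length p < 3"
begin

text \<open>Otherwise \<open>apath_through_ball\<close> joins \<open>u\<close> to \<open>v\<close>
  by a path of length at least 2, which the arc back closes to a cycle.\<close>

lemma graph_dist_arc_neq:
  assumes "(u, v) \<in> parcs G" "w \<in> pverts G"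
  shows "d u w \<noteq> d v w"
proof
  assume eq: "d u w = d v w"
  have vu: "(v, u) \<in> parcs G" using assms arcs_symmetric by blast
  obtain p where p: "apath u p v" "2 \<le> length p"
    using apath_through_ball[of w u v "d v w"] eq assms in_arcsD1 in_arcsD2 no_loops' by blast
  then have "awalk v ((v, u) # p) v" "distinct (tl (awalk_verts v ((v, u) # p)))"
    using vu by (auto simp: apath_def awalk_Cons_iff)
  then have "cycle ((v, u) # p)" by (auto simp: cycle_def)
  then show False using acyclic p by fastforce
qed

text \<open>Otherwise the path between \<open>v\<close> and \<open>v'\<close> given by
  \<open>apath_through_ball\<close> stays nearer to \<open>w\<close> than \<open>u\<close>, so
  passing through \<open>u\<close> closes it to a cycle.\<close>

lemma graph_dist_descend_unique:
  assumes "(u, v) \<in> parcs G" "(u, v') \<in> parcs G" "w \<in> pverts G"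
    and "d u w = Suc (d v w)" "d u w = Suc (d v' w)"
  shows "v = v'"
proof (rule ccontr)
  assume "v \<noteq> v'"
  have v'u: "(v', u) \<in> parcs G" using assms arcs_symmetric by blast
  obtain p where p: "apath v p v'" "2 \<le> length p"
    "set (awalk_verts v p) \<subseteq> {v, v'} \<union> {x. d x w < d v w}"
    using apath_through_ball[of w v v' "d v w"] assms in_arcsD2 \<open>v \<noteq> v'\<close> by (metis Suc_inject)
  then have "u \<notin> set (awalk_verts v p)" using assms by auto
  with p(1) have "awalk v' ((v', u) # (u, v) # p) v'"
    "distinct (tl (awalk_verts v' ((v', u) # (u, v) # p)))"
    using v'u assms by (auto simp: apath_def awalk_Cons_iff)
  then have "cycle ((v', u) # (u, v) # p)" by (auto simp: cycle_def)
  then show False using acyclic p by fastforce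
qed

lemma graph_dist_arc_cases:
  assumes "(u, v) \<in> parcs G" "w \<in> pverts G"
  obtains "d u w = Suc (d v w)" | "d v w = Suc (d u w)"
proof -
  have "(v, u) \<in> parcs G" using assms arcs_symmetric by blast
  from graph_dist_arc_le[OF assms] graph_dist_arc_le[OF this assms(2)] graph_dist_arc_neq[OF assms] that
  show thesis by linarith
qed

lemma awalk_parity:
  assumes "awalk u p v" "w \<in> pverts G"
  shows "even (d u w + d v w + length p)"
  using assms(1)
proof (induction p arbitrary: u)
  case Nil
  then show ?case by (auto simp: awalk_Nil_iff)
next
  case (Cons e p)
  then obtain x where x: "e = (u, x)" "(u, x) \<in> parcs G" "awalk x p v"
    by (cases e) (auto simp: awalk_Cons_iff)
  then have "even (d x w + d v w + length p)" by (intro Cons.IH)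
  with graph_dist_arc_cases[OF x(2) assms(2)] x(1) show ?case
    by (metis (no_types, lifting) add_Suc add_Suc_right even_Suc length_Cons)
qed

text \<open>Both sums have the parity of the length of one and the same walk from \<open>u\<close>
  to \<open>v\<close>.\<close>

lemma graph_dist_parity:
  assumes "u \<in> pverts G" "v \<in> pverts G" "w \<in> pverts G" "w' \<in> pverts G"
  shows "even (d u w + d v w) \<longleftrightarrow> even (d u w' + d v w')"
proof -
  obtain p where "awalk u p v" using graph_dist_awalk assms by metis
  from awalk_parity[OF this assms(3)] awalk_parity[OF this assms(4)] show ?thesis by presburger
qed

text \<open>The arc separates \<open>v\<close>, on the side of \<open>u'\<close>, from
  \<open>w\<close>, on the side of \<open>u\<close>. The induction pushes the arc towards
  \<open>v\<close>.\<close>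

lemma graph_dist_separated:
  assumes "(u, u') \<in> parcs G" "v \<in> pverts G" "w \<in> pverts G"
    and "d u v = Suc (d u' v)" "d u' w = Suc (d u w)"
  shows "d v w = d v u + d u w"
  using assms
proof (induction "d u' v" arbitrary: u u')
  case 0
  then have "u' = v" using graph_dist_eq_0_iff in_arcsD2 by metis
  moreover have "d u v = d v u" using 0 graph_dist_commute in_arcsD1 by metis
  ultimately show ?case using 0 by auto
next
  case (Suc k)
  have u': "u' \<in> pverts G" and u: "u \<in> pverts G" and u'u: "(u', u) \<in> parcs G"
    using Suc.prems in_arcsD1 in_arcsD2 arcs_symmetric by blast+
  obtain x where x: "(u', x) \<in> parcs G" "d u' v = Suc (d x v)"
    using graph_dist_descend[OF u', of v] Suc by auto
  \<comment> \<open>The only neighbour of \<open>u'\<close> nearer to \<open>w\<close> is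
    \<open>u\<close>, and \<open>x\<close> differs from \<open>u\<close> because their distances to
    \<open>v\<close> differ.\<close>
  have "d u' w \<noteq> Suc (d x w)"
    using graph_dist_descend_unique[OF u'u x(1), of w] x Suc.prems by auto
  then have "d x w = Suc (d u' w)"
    using graph_dist_arc_cases[OF x(1) Suc.prems(3)] by blast
  then have "d v w = d v u' + d u' w"
    using Suc.hyps x Suc.prems by auto
  then show ?case
    using Suc.prems graph_dist_commute[of u v] graph_dist_commute[of u' v] u u' by auto
qed

text \<open>In a tree these are the vertices of the subtree spanned by \<open>range W\<close>.\<close>

definition inner :: "('n::finite \<Rightarrow> 'a) \<Rightarrow> 'a \<Rightarrow> bool" where
  "inner W u \<longleftrightarrow> u \<in> pverts G \<and>
     \<not> (\<exists>v. (u, v) \<in> parcs G \<and> (\<forall>i. d u (W i) = Suc (d v (W i))))"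

context
  fixes W :: "'n::finite \<Rightarrow> 'a"
  assumes W: "range W \<subseteq> pverts G"
begin

lemma W_in_pverts: "W i \<in> pverts G"
  using W by auto

text \<open>Some \<open>W i\<close> is not nearer to the neighbour of \<open>v\<close> in the
  direction of \<open>u\<close> than to \<open>v\<close> itself. The arc to that neighbour then
  separates \<open>u\<close> from \<open>W i\<close>, so \<open>v\<close> lies on a shortest path
  between them.\<close>

lemma inner_extend:
  assumes "inner W v" "u \<in> pverts G"
  shows "\<exists>i. d u (W i) = d u v + d v (W i)"
proof (cases "u = v")
  case True
  then show ?thesis using assms graph_dist_eq_0_iff by auto
next
  case False
  have v: "v \<in> pverts G" using assms by (simp add: inner_def)
  then obtain v' where v': "(v, v') \<in> parcs G" "d v u = Suc (d v' u)"
    using graph_dist_descend[of v u] False assms graph_dist_eq_0_iff by metis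
  then obtain i where "d v (W i) \<noteq> Suc (d v' (W i))"
    using assms by (auto simp: inner_def)
  then have "d v' (W i) = Suc (d v (W i))"
    using graph_dist_arc_cases[OF v'(1) W_in_pverts] by blast
  then show ?thesis
    using graph_dist_separated[OF v'(1) assms(2) W_in_pverts v'(2)] by blast
qed

text \<open>Membership in \<open>S\<^sub>0\<close> concerns all vertices, whereas
  \<open>inner\<close> looks at neighbours only. They agree because \<open>inner_extend\<close>
  gives every vertex some \<open>W i\<close> at least as far from it as from
  \<open>u\<close>.\<close>

lemma inner_iff:
  assumes "u \<in> pverts G"
  shows "inner W u \<longleftrightarrow> \<not> (\<exists>v \<in> pverts G. \<forall>i. d u (W i) = Suc (d v (W i)))"
proof
  assume "inner W u"
  then show "\<not> (\<exists>v \<in> pverts G. \<forall>i. d u (W i) = Suc (d v (W i)))"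
    using inner_extend by (metis add_leD2 not_less_eq_eq order_refl)
next
  assume "\<not> (\<exists>v \<in> pverts G. \<forall>i. d u (W i) = Suc (d v (W i)))"
  then show "inner W u" using assms in_arcsD2 unfolding inner_def by blast
qed

text \<open>If \<open>v\<close> had a neighbour \<open>v'\<close> nearer to every
  \<open>W i\<close>, unique descent would leave \<open>u\<close> farther than \<open>v\<close> from
  every \<open>W i\<close>, contradicting \<open>inner W u\<close>.\<close>

lemma inner_descend:
  assumes "inner W u" "(u, v) \<in> parcs G" "d u (W j) = Suc (d v (W j))"
  shows "inner W v"
proof (rule ccontr)
  assume "\<not> inner W v"
  then obtain v' where v': "(v, v') \<in> parcs G" "\<And>i. d v (W i) = Suc (d v' (W i))"
    using assms(2) in_arcsD2 by (auto simp: inner_def)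
  have vu: "(v, u) \<in> parcs G" using assms arcs_symmetric by blast
  have "v' \<noteq> u" using assms(3) v'(2)[of j] by auto
  then have "d v (W i) \<noteq> Suc (d u (W i))" for i
    using graph_dist_descend_unique[OF v'(1) vu W_in_pverts v'(2)] by blast
  then have "d u (W i) = Suc (d v (W i))" for i
    using graph_dist_arc_cases[OF assms(2) W_in_pverts[of i]] by blast
  then show False using assms by (auto simp: inner_def)
qed

text \<open>For the \<open>i\<close> from \<open>inner_extend\<close>, the difference of the
  \<open>i\<close>-th coordinates is the full distance \<open>d u v\<close>, which is therefore at
  most 1.\<close>

lemma arc_if_close_to_inner:
  assumes "inner W v" "u \<in> pverts G" "u \<noteq> v" "\<And>i. d u (W i) \<le> Suc (d v (W i))"
  shows "(u, v) \<in> parcs G"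
proof -
  have v: "v \<in> pverts G" using assms by (simp add: inner_def)
  obtain i where "d u (W i) = d u v + d v (W i)" using inner_extend assms by blast
  with assms(4)[of i] have "d u v \<le> 1" by simp
  moreover have "d u v \<noteq> 0" using assms v graph_dist_eq_0_iff by blast
  ultimately show ?thesis using graph_dist_eq_1_imp_arc assms(2) v by simp
qed

end

end

section \<open>Distance vectors and the maximum distance\<close>

lemma dist_vector_nth [simp]: "dist_vector G W u $ i = int (graph_dist G u (W i))"
  by (simp add: dist_vector_def)

lemma Max_abs_diff_eq_1_iff:
  fixes x y :: "int ^ 'n::finite"
  shows "(MAX i. \<bar>x $ i - y $ i\<bar>) = 1 \<longleftrightarrow> x \<noteq> y \<and> (\<forall>i. \<bar>x $ i - y $ i\<bar> \<le> 1)"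
proof -
  define g where "g = (\<lambda>i. \<bar>x $ i - y $ i\<bar>)"
  have "Max (range g) = 1 \<longleftrightarrow> 1 \<in> range g \<and> (\<forall>a \<in> range g. a \<le> 1)"
    by (rule Max_eq_iff) auto
  also have "1 \<in> range g \<longleftrightarrow> (\<exists>i. g i = 1)"
    by (metis rangeE rangeI)
  finally have "Max (range g) = 1 \<longleftrightarrow> (\<exists>i. g i = 1) \<and> (\<forall>i. g i \<le> 1)"
    by simp
  then have "(MAX i. \<bar>x $ i - y $ i\<bar>) = 1 \<longleftrightarrow>
      (\<exists>i. \<bar>x $ i - y $ i\<bar> = 1) \<and> (\<forall>i. \<bar>x $ i - y $ i\<bar> \<le> 1)"
    by (simp only: g_def)
  also have "\<dots> \<longleftrightarrow> x \<noteq> y \<and> (\<forall>i. \<bar>x $ i - y $ i\<bar> \<le> 1)"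
  proof -
    have "(\<exists>i. \<bar>x $ i - y $ i\<bar> = 1) \<longleftrightarrow> x \<noteq> y" if "\<forall>i. \<bar>x $ i - y $ i\<bar> \<le> 1"
    proof -
      have "\<bar>x $ i - y $ i\<bar> = 1 \<longleftrightarrow> x $ i \<noteq> y $ i" for i
        using that[rule_format, of i] by linarith
      then show ?thesis by (simp add: vec_eq_iff)
    qed
    then show ?thesis by blast
  qed
  finally show ?thesis .
qed

lemma shifted_dist_vector_in_iff:
  assumes "S = dist_vector G W ` pverts G"
  shows "(\<chi> i. dist_vector G W u $ i - 1) \<in> S \<longleftrightarrow>
    (\<exists>v \<in> pverts G. \<forall>i. graph_dist G u (W i) = Suc (graph_dist G v (W i)))"
proof -
  have "int a - 1 = int b \<longleftrightarrow> a = Suc b" for a b by linarith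
  then show ?thesis unfolding assms by (auto simp: image_iff vec_eq_iff)
qed

section \<open>Necessity of (i) and (ii)\<close>

lemma tree_realization_imp:
  fixes S S\<^sub>0 S\<^sub>1 :: "(int ^ 'n::finite) set"
  assumes real: "is_realization S T W" and tree: "tree_graph T"
    and S1: "S\<^sub>1 = {x \<in> S. (\<chi> i. x $ i - 1) \<in> S}"
    and S0: "S\<^sub>0 = S - S\<^sub>1"
  shows "\<forall>x\<in>S. \<forall>y\<in>S. (MAX i. \<bar>x $ i - y $ i\<bar>) = 1 \<longrightarrow> (\<forall>j. x $ j \<noteq> y $ j)"
    and "\<forall>x\<in>S\<^sub>0. \<forall>j. x $ j > 0 \<longrightarrow>
      (\<exists>!y. y \<in> S\<^sub>0 \<and> (MAX i. \<bar>x $ i - y $ i\<bar>) = 1 \<and> y $ j = x $ j - 1)"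
proof -
  interpret pair_graph T using tree by (auto simp: tree_graph_def connected_graph_def)
  interpret pair_tree T
  proof unfold_locales
    show "Digraph_Component.connected (with_proj T)"
      using tree by (simp add: tree_graph_def connected_graph_def)
    show "length p < 3" if "cycle p" for p
      using tree that unfolding tree_graph_def by (meson not_le)
  qed
  let ?r = "dist_vector T W"
  have S: "S = ?r ` pverts T" and W: "range W \<subseteq> pverts T" and inj: "inj_on ?r (pverts T)"
    using real by (auto simp: is_realization_def resolving_def)
  have Wj: "W j \<in> pverts T" for j using W by auto
  have r_eq: "?r u = ?r v \<longleftrightarrow> u = v" if "u \<in> pverts T" "v \<in> pverts T" for u v
    using inj that by (auto dest: inj_onD)
  have S0_iff: "?r u \<in> S\<^sub>0 \<longleftrightarrow> inner W u" if "u \<in> pverts T" for u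
    using that inner_iff[OF W that] shifted_dist_vector_in_iff[OF S, of u]
    by (auto simp: S0 S1 S)
  have S0_obtain: thesis if "x \<in> S\<^sub>0" "\<And>u. x = ?r u \<Longrightarrow> inner W u \<Longrightarrow> u \<in> pverts T \<Longrightarrow> thesis" for x thesis
    using that S0_iff S0 S by auto
  show "\<forall>x\<in>S. \<forall>y\<in>S. (MAX i. \<bar>x $ i - y $ i\<bar>) = 1 \<longrightarrow> (\<forall>j. x $ j \<noteq> y $ j)"
  proof (intro ballI impI allI notI)
    fix x y j assume x: "x \<in> S" and y: "y \<in> S" and max: "(MAX i. \<bar>x $ i - y $ i\<bar>) = 1" and "x $ j = y $ j"
    from x y obtain u v where u: "u \<in> pverts T" "x = ?r u" and v: "v \<in> pverts T" "y = ?r v"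
      by (auto simp: S)
    from max obtain i where i: "x $ i \<noteq> y $ i" "\<bar>x $ i - y $ i\<bar> \<le> 1"
      unfolding Max_abs_diff_eq_1_iff vec_eq_iff by auto
    then have "d u (W i) = Suc (d v (W i)) \<or> d v (W i) = Suc (d u (W i))"
      using u v by auto
    moreover have "d u (W j) = d v (W j)" using \<open>x $ j = y $ j\<close> u v by simp
    \<comment> \<open>Coordinate \<open>i\<close> makes the sum of the two distances odd, coordinate
      \<open>j\<close> makes it even.\<close>
    ultimately show False
      using graph_dist_parity[OF u(1) v(1) Wj[of i] Wj[of j]] by auto
  qed
  show "\<forall>x\<in>S\<^sub>0. \<forall>j. x $ j > 0 \<longrightarrow>
      (\<exists>!y. y \<in> S\<^sub>0 \<and> (MAX i. \<bar>x $ i - y $ i\<bar>) = 1 \<and> y $ j = x $ j - 1)"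
  proof (intro ballI allI impI)
    fix x j assume "x \<in> S\<^sub>0" and pos: "x $ j > 0"
    then obtain u where u: "x = ?r u" "inner W u" "u \<in> pverts T" using S0_obtain by blast
    obtain v where v: "(u, v) \<in> parcs T" "d u (W j) = Suc (d v (W j))"
      using graph_dist_descend[OF u(3) Wj[of j]] pos u by auto
    have vV: "v \<in> pverts T" using v in_arcsD2 by blast
    show "\<exists>!y. y \<in> S\<^sub>0 \<and> (MAX i. \<bar>x $ i - y $ i\<bar>) = 1 \<and> y $ j = x $ j - 1"
    proof (intro ex1I[of _ "?r v"] conjI)
      show "?r v \<in> S\<^sub>0" using S0_iff[OF vV] inner_descend[OF W u(2) v] by blast
      have "\<bar>x $ i - ?r v $ i\<bar> \<le> 1" for i
        using graph_dist_arc_cases[OF v(1) Wj[of i]] u by force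
      moreover have "x \<noteq> ?r v" using v u r_eq vV no_loops' by auto
      ultimately show "(MAX i. \<bar>x $ i - ?r v $ i\<bar>) = 1"
        unfolding Max_abs_diff_eq_1_iff by blast
      show "?r v $ j = x $ j - 1" using u v by simp
    next
      fix y assume y: "y \<in> S\<^sub>0 \<and> (MAX i. \<bar>x $ i - y $ i\<bar>) = 1 \<and> y $ j = x $ j - 1"
      then obtain v' where v': "y = ?r v'" "inner W v'" "v' \<in> pverts T" using S0_obtain by blast
      have "\<bar>x $ i - y $ i\<bar> \<le> 1" for i
        using y unfolding Max_abs_diff_eq_1_iff by blast
      then have "d u (W i) \<le> Suc (d v' (W i))" for i
        using u v' by (simp add: abs_le_iff) (metis (no_types) diff_le_eq of_nat_Suc of_nat_le_iff add.commute)
      moreover have lower: "d u (W j) = Suc (d v' (W j))" using y u v' by simp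
      \<comment> \<open>As \<open>v'\<close> is inner, closeness of the vectors forces adjacency;
        \<open>lower\<close> rules out \<open>u = v'\<close>.\<close>
      ultimately have "(u, v') \<in> parcs T"
        using arc_if_close_to_inner[OF W v'(2) u(3)] by fastforce
      then show "y = ?r v"
        using graph_dist_descend_unique[OF _ v(1) Wj lower v(2)] v' by blast
    qed
  qed
qed

section \<open>Sufficiency: rebuilding the arcs\<close>

lemma ex_tree_realization:
  fixes S S\<^sub>0 S\<^sub>1 :: "(int ^ 'n::finite) set" and G :: "'v pair_pre_digraph"
  assumes real: "is_realization S G W"
    and S1: "S\<^sub>1 = {x \<in> S. (\<chi> i. x $ i - 1) \<in> S}"
    and S0: "S\<^sub>0 = S - S\<^sub>1"
    and parity: "\<forall>x\<in>S. \<forall>y\<in>S. (MAX i. \<bar>x $ i - y $ i\<bar>) = 1 \<longrightarrow> (\<forall>j. x $ j \<noteq> y $ j)"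
    and unique: "\<forall>x\<in>S\<^sub>0. \<forall>j. x $ j > 0 \<longrightarrow>
      (\<exists>!y. y \<in> S\<^sub>0 \<and> (MAX i. \<bar>x $ i - y $ i\<bar>) = 1 \<and> y $ j = x $ j - 1)"
  shows "\<exists>T :: 'v pair_pre_digraph. is_realization S T W \<and> tree_graph T"
proof -
  interpret G: pair_graph G using real by (auto simp: is_realization_def connected_graph_def)
  interpret G: connected_pair_graph G
    using real by unfold_locales (auto simp: is_realization_def connected_graph_def)
  let ?r = "dist_vector G W"
  have S: "S = ?r ` pverts G" and W: "range W \<subseteq> pverts G" and inj: "inj_on ?r (pverts G)"
    using real by (auto simp: is_realization_def resolving_def)
  have Wj: "W j \<in> pverts G" for j using W by auto
  have r_eq: "u = v" if "u \<in> pverts G" "v \<in> pverts G" "?r u = ?r v" for u v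
    using inj that by (auto dest: inj_onD)
  have rS: "?r u \<in> S" if "u \<in> pverts G" for u using that S by blast
  define below where "below u v \<longleftrightarrow> (\<forall>i. G.d u (W i) = Suc (G.d v (W i)))" for u v
  have S0_iff: "?r u \<in> S\<^sub>0 \<longleftrightarrow> \<not> (\<exists>v \<in> pverts G. below u v)" if "u \<in> pverts G" for u
    using that shifted_dist_vector_in_iff[OF S, of u] by (auto simp: S0 S1 S below_def)
  \<comment> \<open>Vertices and \<open>W\<close> are kept. Since \<open>below u v\<close> means
    that the vector of \<open>v\<close> is that of \<open>u\<close> minus the all-ones vector, it
    attaches each \<open>u\<close> outside \<open>S\<^sub>0\<close> to a single vertex.\<close>
  define T where "T = \<lparr>pverts = pverts G, parcs = {(u, v). u \<in> pverts G \<and> v \<in> pverts G \<and>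
    (?r u \<in> S\<^sub>0 \<and> ?r v \<in> S\<^sub>0 \<and> (MAX i. \<bar>?r u $ i - ?r v $ i\<bar>) = 1 \<or> below u v \<or> below v u)}\<rparr>"
  have vT: "pverts T = pverts G" by (simp add: T_def)
  have aT: "(u, v) \<in> parcs T \<longleftrightarrow> u \<in> pverts G \<and> v \<in> pverts G \<and>
    (?r u \<in> S\<^sub>0 \<and> ?r v \<in> S\<^sub>0 \<and> (MAX i. \<bar>?r u $ i - ?r v $ i\<bar>) = 1 \<or> below u v \<or> below v u)" for u v
    by (simp add: T_def)
  have step: "G.d u (W j) = Suc (G.d v (W j)) \<or> G.d v (W j) = Suc (G.d u (W j))"
    if uv: "(u, v) \<in> parcs T" for u v j
  proof (cases "below u v \<or> below v u")
    case True
    then show ?thesis by (auto simp: below_def)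
  next
    case False
    with uv have m: "u \<in> pverts G" "v \<in> pverts G" "(MAX i. \<bar>?r u $ i - ?r v $ i\<bar>) = 1"
      by (auto simp: aT)
    \<comment> \<open>Condition (i) excludes a difference of 0, leaving exactly 1.\<close>
    then have "?r u $ j \<noteq> ?r v $ j" using parity rS by blast
    moreover have "\<bar>?r u $ j - ?r v $ j\<bar> \<le> 1"
      using m(3) unfolding Max_abs_diff_eq_1_iff by blast
    ultimately show ?thesis by auto
  qed
  have descend: "\<exists>v. (u, v) \<in> parcs T \<and> G.d u (W j) = Suc (G.d v (W j))"
    if u: "u \<in> pverts G" and pos: "G.d u (W j) \<noteq> 0" for u j
  proof (cases "?r u \<in> S\<^sub>0")
    case True
    then obtain y where y: "y \<in> S\<^sub>0" "(MAX i. \<bar>?r u $ i - y $ i\<bar>) = 1" "y $ j = ?r u $ j - 1"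
      using unique pos by (metis dist_vector_nth of_nat_0_less_iff bot_nat_0.not_eq_extremum)
    then obtain v where v: "v \<in> pverts G" "y = ?r v" by (auto simp: S0 S)
    then have "G.d u (W j) = Suc (G.d v (W j))" using y by simp
    then show ?thesis using True u v y by (auto simp: aT)
  next
    case False
    then show ?thesis using S0_iff[OF u] u by (auto simp: aT below_def)
  qed
  have descend_unique: "v = v'"
    if uv: "(u, v) \<in> parcs T" "(u, v') \<in> parcs T"
      and less: "G.d v (W j) < G.d u (W j)" "G.d v' (W j) < G.d u (W j)" for u v v' j
  proof -
    have V: "u \<in> pverts G" "v \<in> pverts G" "v' \<in> pverts G" using uv by (auto simp: aT)
    have nb: "\<not> below v u" "\<not> below v' u" 
      using less by (metis below_def lessI less_asym)+
    show ?thesis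
    \<comment> \<open>Inside \<open>S\<^sub>0\<close> both arcs come from max-distance 1, and (ii)
      applies; outside, both are \<open>below\<close> arcs, and the vector of \<open>u\<close>
      determines that of the lower end.\<close>
    proof (cases "?r u \<in> S\<^sub>0")
      case True
      then have m: "?r v \<in> S\<^sub>0" "?r v' \<in> S\<^sub>0" "(MAX i. \<bar>?r u $ i - ?r v $ i\<bar>) = 1"
        "(MAX i. \<bar>?r u $ i - ?r v' $ i\<bar>) = 1"
        using nb uv S0_iff[OF V(1)] by (auto simp: aT)
      have "?r v $ j = ?r u $ j - 1" "?r v' $ j = ?r u $ j - 1"
        using step[OF uv(1), of j] step[OF uv(2), of j] less by auto
      moreover have "?r u $ j > 0" using less by simp
      ultimately have "?r v = ?r v'" using unique True m by blast
      then show ?thesis using r_eq V by blast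
    next
      case False
      then have "below u v" "below u v'" using uv nb by (auto simp: aT)
      then have "?r v = ?r v'" by (simp add: below_def vec_eq_iff)
      then show ?thesis using r_eq V by blast
    qed
  qed
  interpret T: pair_graph T
  proof unfold_locales
    show "finite (pverts T)" using G.pair_finite_verts by (simp add: vT)
    have "parcs T \<subseteq> pverts G \<times> pverts G" by (auto simp: aT)
    then show "finite (parcs T)" using G.pair_finite_verts finite_subset by blast
    show "symmetric (with_proj T)"
      by (auto simp: symmetric_def sym_def aT abs_minus_commute)
    show "fst e \<noteq> snd e" if "e \<in> parcs T" for e
      using step[of "fst e" "snd e"] that by auto
  qed (auto simp: aT vT)
  have le: "G.d a (W j) \<le> Suc (G.d b (W j))" if "(a, b) \<in> parcs T" for a b j
    using step[OF that, of j] by auto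
  have zero: "a = W j" if "a \<in> pverts T" "G.d a (W j) = 0" for a j
    using that G.graph_dist_eq_0_iff Wj by (simp add: vT)
  have W0: "G.d (W j) (W j) = 0" for j using G.graph_dist_eq_0_iff Wj by blast
  have desc: "\<exists>b. (a, b) \<in> parcs T \<and> G.d a (W j) = Suc (G.d b (W j))"
    if "a \<in> pverts T" "G.d a (W j) \<noteq> 0" for a j
    using descend that by (simp add: vT)
  \<comment> \<open>The distance to \<open>W j\<close> in \<open>G\<close> is a height function on
    \<open>T\<close>, so replacing the arcs leaves all vectors unchanged.\<close>
  have dist: "graph_dist T u (W j) = G.d u (W j)" if "u \<in> pverts T" for u j
    by (rule T.graph_dist_eqI(2)[where f = "\<lambda>u. G.d u (W j)", OF le desc zero W0 that])
  have walk: "\<exists>p. T.awalk u p (W j)" if "u \<in> pverts T" for u j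
    by (rule T.graph_dist_eqI(1)[where f = "\<lambda>u. G.d u (W j)", OF le desc zero W0 that])
  have conn: "Digraph_Component.connected (with_proj T)"
  proof (rule T.connectedI)
    show "pverts T \<noteq> {}" using Wj by (auto simp: vT)
    fix u v assume "u \<in> pverts T" "v \<in> pverts T"
    \<comment> \<open>Two vertices are linked through one common vertex of \<open>W\<close>;
      \<open>undefined\<close> is just an arbitrary index.\<close>
    then obtain p q where "T.awalk u p (W undefined)" "T.awalk v q (W undefined)"
      using walk by meson
    then have "T.awalk u (p @ rev_path q) v"
      by (meson T.awalk_appendI T.awalk_rev_path)
    then show "u \<rightarrow>\<^sup>*\<^bsub>with_proj (mk_symmetric (with_proj T))\<^esub> v"
      using T.reachable_mk_symmetricI T.reachable_awalkI by blast
  qed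
  have r_T: "dist_vector T W u = ?r u" if "u \<in> pverts T" for u
    using dist[OF that] by (simp add: vec_eq_iff)
  then have "inj_on (dist_vector T W) (pverts T)" "dist_vector T W ` pverts T = S"
    using inj by (simp_all add: vT S inj_on_def)
  then have "is_realization S T W"
    using real conn T.pair_graph
    by (simp add: is_realization_def connected_graph_def resolving_def vT)
  moreover have "tree_graph T"
    unfolding tree_graph_def connected_graph_def
  proof (intro conjI notI)
    assume "\<exists>p. T.cycle p \<and> 3 \<le> length p"
    then obtain p where p: "T.cycle p" "3 \<le> length p" by blast
    \<comment> \<open>A single coordinate suffices as the height function that excludes
      cycles.\<close>
    have neq: "G.d a (W undefined) \<noteq> G.d b (W undefined)" if "(a, b) \<in> parcs T" for a b
      using step[OF that] by (metis n_not_Suc_n)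
    show False
      by (rule T.no_cycle_if_unique_descent[where f = "\<lambda>u. G.d u (W undefined)", OF neq descend_unique p])
  qed (use conn T.pair_graph in auto)
  ultimately show ?thesis by blast
qed

theorem theorem4p3:
  fixes S S\<^sub>0 S\<^sub>1 :: "(int ^ 'n::finite) set"
  assumes "realizable S"
    and "S\<^sub>1 = {x \<in> S. (\<chi> i. x $ i - 1) \<in> S}"
    and "S\<^sub>0 = S - S\<^sub>1"
  shows "(\<exists>(T :: nat pair_pre_digraph) W. is_realization S T W \<and> tree_graph T) \<longleftrightarrow>
    (\<forall>x\<in>S. \<forall>y\<in>S. (MAX i. \<bar>x $ i - y $ i\<bar>) = 1 \<longrightarrow> (\<forall>j. x $ j \<noteq> y $ j)) \<and>
    (\<forall>x\<in>S\<^sub>0. \<forall>j. x $ j > 0 \<longrightarrow>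
      (\<exists>!y. y \<in> S\<^sub>0 \<and> (MAX i. \<bar>x $ i - y $ i\<bar>) = 1 \<and> y $ j = x $ j - 1))"
proof (intro iffI, goal_cases)
  case 1
  then show ?case using tree_realization_imp[OF _ _ assms(2,3)] by blast
next
  case 2
  obtain G :: "nat pair_pre_digraph" and W where "is_realization S G W"
    using assms(1) by (auto simp: realizable_def)
  from ex_tree_realization[OF this assms(2,3)] 2 show ?case by blast
qed

end
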